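(* Let $X$ be a strongly connected finite digraph with $\delta(X)=0$. Then $$\mathcal{BF}_X(\mathcal{L}(X))\subseteq\mathcal{BF}_X(\mathbb{Z}V_X)\subseteq\mathcal{L}(X),$$ and $\mathrm{rank}_{\mathbb{Z}}\mathcal{BF}_X(\mathcal{L}(X))=\mathrm{rank}_{\mathbb{Z}}\mathcal{BF}_X(\mathbb{Z}V_X)=\mathrm{rank}_{\mathbb{Z}}\mathcal{L}(X)$.
   Context: Digraph $X=(V_X,E_X)$ with incidence $e\mapsto(o(e),t(e))$; strongly connected means a directed path exists between any two distinct vertices. For finite $X$: $\mathcal{A}_X(v)=\sum_{o(e)=v}t(e)$ on $\mathbb{Z}V_X$, $\mathcal{BF}_X=\mathcal{I}-\mathcal{A}_X$, $\mathrm{BF}(X)=\mathrm{coker}\,\mathcal{BF}_X$, $g_X(u)=\det(\mathcal{I}-\mathcal{A}_Xu)$, $r_X=\mathrm{ord}_{u=1}g_X$, $\delta(X)=r_X-\mathrm{rank}_{\mathbb{Z}}\mathrm{BF}(X)$. Writing $\mathcal{BF}_{\mathbb{Q}}$ for the extension to $\mathbb{Q}V_X$, one has (when $\delta(X)=0$) the decomposition $\mathbb{Q}V_X=\ker\mathcal{BF}_{\mathbb{Q}}\oplus W$ with $W=\mathrm{Im}\,\mathcal{BF}_{\mathbb{Q}}$, and $\mathcal{L}(X)=\mathbb{Z}V_X\cap W$ (with $\mathbb{Z}V_X\subseteq\mathbb{Q}V_X$). *)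

theory Defs
  imports "HOL-Analysis.Analysis" "HOL-Computational_Algebra.Polynomial"
begin

text \<open>A finite digraph: vertices = the finite type 'v, edges = a finite set E of
  some type 'e, with origin and terminus maps o, t.\<close>

definition strongly_connected :: "'e set \<Rightarrow> ('e \<Rightarrow> 'v) \<Rightarrow> ('e \<Rightarrow> 'v) \<Rightarrow> bool" where
  "strongly_connected E o' t \<longleftrightarrow>
     (\<forall>u v. u \<noteq> v \<longrightarrow> (u, v) \<in> {(o' e, t e) | e. e \<in> E}\<^sup>+)"

text \<open>Matrix of the adjacency operator A_X on ZV_X w.r.t. the vertex basis:
  A_X(v) = sum of t(e) over edges e with o(e) = v, so entry (w,v) counts edges v -> w.\<close>
definition adj_mat :: "'e set \<Rightarrow> ('e \<Rightarrow> 'v::finite) \<Rightarrow> ('e \<Rightarrow> 'v) \<Rightarrow> int^'v^'v" where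
  "adj_mat E o' t = (\<chi> w v. int (card {e \<in> E. o' e = v \<and> t e = w}))"

definition BF_mat :: "'e set \<Rightarrow> ('e \<Rightarrow> 'v::finite) \<Rightarrow> ('e \<Rightarrow> 'v) \<Rightarrow> int^'v^'v" where
  "BF_mat E o' t = mat 1 - adj_mat E o' t"

text \<open>The operator BF_X on ZV_X = int^'v.\<close>
definition BF :: "'e set \<Rightarrow> ('e \<Rightarrow> 'v::finite) \<Rightarrow> ('e \<Rightarrow> 'v) \<Rightarrow> int^'v \<Rightarrow> int^'v" where
  "BF E o' t x = BF_mat E o' t *v x"

text \<open>Its extension to QV_X = rat^'v.\<close>
definition BF_Q :: "'e set \<Rightarrow> ('e \<Rightarrow> 'v::finite) \<Rightarrow> ('e \<Rightarrow> 'v) \<Rightarrow> rat^'v \<Rightarrow> rat^'v" where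
  "BF_Q E o' t x = (\<chi> i j. of_int (BF_mat E o' t $ i $ j)) *v x"

definition to_Q :: "int^'v \<Rightarrow> rat^'v" where
  "to_Q z = (\<chi> i. of_int (z $ i))"

text \<open>g_X(u) = det(I - A_X u) as an integer polynomial.\<close>
definition zeta_poly :: "'e set \<Rightarrow> ('e \<Rightarrow> 'v::finite) \<Rightarrow> ('e \<Rightarrow> 'v) \<Rightarrow> int poly" where
  "zeta_poly E o' t =
     det ((\<chi> i j. (if i = j then 1 else 0) - [:0, of_int (adj_mat E o' t $ i $ j):]) :: int poly^'v^'v)"

text \<open>r_X = order of vanishing of g_X at u = 1.\<close>
definition r_X :: "'e set \<Rightarrow> ('e \<Rightarrow> 'v::finite) \<Rightarrow> ('e \<Rightarrow> 'v) \<Rightarrow> nat" where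
  "r_X E o' t = order 1 (zeta_poly E o' t)"

text \<open>Z-linear independence of a finite set F of vectors modulo a subgroup H.\<close>
definition zindep_mod :: "(int^'v) set \<Rightarrow> (int^'v) set \<Rightarrow> bool" where
  "zindep_mod H F \<longleftrightarrow>
     (\<forall>c :: int^'v \<Rightarrow> int. (\<Sum>x\<in>F. c x *s x) \<in> H \<longrightarrow> (\<forall>x\<in>F. c x = 0))"

text \<open>Rank of the abelian group S/H (for subgroups H \<subseteq> S of int^'v): maximal size of a
  subset of S that is Z-linearly independent modulo H.\<close>
definition zrank_quot :: "(int^'v) set \<Rightarrow> (int^'v) set \<Rightarrow> nat" where
  "zrank_quot S H = Sup (card ` {F. finite F \<and> F \<subseteq> S \<and> zindep_mod H F})"

text \<open>Rank of a subgroup S of int^'v.\<close>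
definition zrank :: "(int^'v) set \<Rightarrow> nat" where
  "zrank S = zrank_quot S {0}"

text \<open>rank_Z BF(X), BF(X) = coker BF_X = ZV_X / BF_X(ZV_X).\<close>
definition rank_BF_group :: "'e set \<Rightarrow> ('e \<Rightarrow> 'v::finite) \<Rightarrow> ('e \<Rightarrow> 'v) \<Rightarrow> nat" where
  "rank_BF_group E o' t = zrank_quot UNIV (range (BF E o' t))"

definition delta :: "'e set \<Rightarrow> ('e \<Rightarrow> 'v::finite) \<Rightarrow> ('e \<Rightarrow> 'v) \<Rightarrow> int" where
  "delta E o' t = int (r_X E o' t) - int (rank_BF_group E o' t)"

text \<open>L(X) = ZV_X \<inter> Im(BF_Q).\<close>
definition L_X :: "'e set \<Rightarrow> ('e \<Rightarrow> 'v::finite) \<Rightarrow> ('e \<Rightarrow> 'v) \<Rightarrow> (int^'v) set" where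
  "L_X E o' t = {z. to_Q z \<in> range (BF_Q E o' t)}"

end

theory Submission
  imports Defs
begin

(* Over the rationals, write M = I - A_X and W = Im M.  The lattice L(X) and the image
   BF_X(ZV_X) both span W (clear denominators), and so does BF_X(L(X)) as soon as M is
   injective on W, i.e. as soon as ker M meets W only in 0; then all three groups have
   Z-rank dim W.  That intersection is trivial when delta(X) = 0: rank BF(X) <= dim ker M by
   rank-nullity, whereas a nonzero v = M w in ker M forces (1 - u)^(dim ker M + 1) to divide
   g_X(u) = det (I - A_X u), because in a basis of ker M extended by w the matrix I - A_X u
   multiplies ker M by 1 - u and sends w to (1 - u) w + u v. *)

section \<open>Integer vectors inside rational vectors\<close>

definition of_int_mat :: "int^'n^'m \<Rightarrow> rat^'n^'m" where
  "of_int_mat A = (\<chi> i j. of_int (A $ i $ j))"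

lemma inj_to_Q: "inj to_Q"
  by (auto simp: inj_def to_Q_def vec_eq_iff)

lemma inj_on_to_Q: "inj_on to_Q F"
  using inj_to_Q by (rule inj_on_subset) simp

lemma card_image_to_Q [simp]: "card (to_Q ` F) = card F"
  by (rule card_image[OF inj_on_to_Q])

lemma finite_image_to_Q_iff [simp]: "finite (to_Q ` F) \<longleftrightarrow> finite F"
  by (rule finite_image_iff[OF inj_on_to_Q])

lemma sum_image_to_Q: "(\<Sum>v\<in>to_Q ` F. f v) = (\<Sum>x\<in>F. f (to_Q x))"
  by (simp add: sum.reindex[OF inj_on_to_Q])

lemma to_Q_0 [simp]: "to_Q 0 = 0"
  and to_Q_add [simp]: "to_Q (x + y) = to_Q x + to_Q y"
  and to_Q_smult [simp]: "to_Q (c *s x) = of_int c *s to_Q x"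
  by (simp_all add: to_Q_def vec_eq_iff)

lemma to_Q_sum: "to_Q (sum f A) = (\<Sum>a\<in>A. to_Q (f a))"
  by (induction A rule: infinite_finite_induct) simp_all

lemma to_Q_mat_vec_mult: "to_Q (A *v z) = of_int_mat A *v to_Q z"
  by (simp add: to_Q_def of_int_mat_def vec_eq_iff matrix_vector_mult_def)

lemma range_to_Q_iff: "x \<in> range to_Q \<longleftrightarrow> (\<forall>i. x $ i \<in> \<int>)"
proof
  assume "\<forall>i. x $ i \<in> \<int>"
  then have "\<forall>i. \<exists>z. x $ i = of_int z"
    by (auto simp: Ints_def)
  then obtain f where "\<forall>i. x $ i = of_int (f i)"
    by (rule choice[THEN exE])
  then have "x = to_Q (\<chi> i. f i)"
    by (simp add: to_Q_def vec_eq_iff)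
  then show "x \<in> range to_Q"
    by blast
qed (auto simp: to_Q_def)

lemma common_denominator:
  fixes A :: "rat set"
  assumes "finite A"
  shows "\<exists>D::int. D > 0 \<and> (\<forall>q\<in>A. of_int D * q \<in> \<int>)"
proof (intro exI conjI ballI)
  define den where "den q = snd (quotient_of q)" for q
  show "(\<Prod>q\<in>A. den q) > 0"
    by (simp add: den_def prod_pos quotient_of_denom_pos')
  fix q assume "q \<in> A"
  obtain a b where ab: "quotient_of q = (a, b)"
    by fastforce
  have "of_int b * q = of_int a"
    using quotient_of_div[OF ab] quotient_of_denom_pos[OF ab] by simp
  moreover have "(\<Prod>q\<in>A. den q) = b * (\<Prod>q\<in>A - {q}. den q)"
    using \<open>q \<in> A\<close> by (simp add: assms prod.remove den_def ab)
  then have "of_int (\<Prod>q\<in>A. den q) * q = (of_int b * q) * of_int (\<Prod>q\<in>A - {q}. den q)"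
    by (simp add: ac_simps)
  ultimately show "of_int (\<Prod>q\<in>A. den q) * q \<in> \<int>"
    by (simp add: Ints_prod)
qed

lemma span_lattice_points:
  fixes W :: "(rat^'n) set"
  assumes W: "vec.subspace W"
  shows "vec.span (to_Q ` {z. to_Q z \<in> W}) = W"
proof (rule antisym)
  show "vec.span (to_Q ` {z. to_Q z \<in> W}) \<subseteq> W"
    by (rule vec.span_minimal) (use W in auto)
  show "W \<subseteq> vec.span (to_Q ` {z. to_Q z \<in> W})"
  proof
    fix w assume "w \<in> W"
    have "finite (range (($) w))"
      by simp
    from common_denominator[OF this]
    obtain D :: int where D: "D > 0" "\<forall>q\<in>range (($) w). of_int D * q \<in> \<int>"
      by blast
    then have "of_int D *s w \<in> range to_Q"
      by (simp add: range_to_Q_iff)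
    then obtain z where z: "to_Q z = of_int D *s w"
      by (auto simp: image_iff)
    then have "to_Q z \<in> W"
      using \<open>w \<in> W\<close> W by (simp add: vec.subspace_scale)
    then have "(1 / of_int D) *s to_Q z \<in> vec.span (to_Q ` {z. to_Q z \<in> W})"
      by (intro vec.span_scale vec.span_base) blast
    then show "w \<in> vec.span (to_Q ` {z. to_Q z \<in> W})"
      using D(1) by (simp add: z)
  qed
qed

lemma span_range_to_Q: "vec.span (range to_Q) = UNIV"
  using span_lattice_points[OF vec.subspace_UNIV] by simp

section \<open>Linear algebra over a field\<close>

lemma span_inter_span_Diff:
  fixes S :: "('a::field^'n) set"
  assumes "vec.independent S" "B \<subseteq> S"
  shows "vec.span B \<inter> vec.span (S - B) = {0}"
proof -
  have fin: "finite S"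
    using assms(1) by (rule vec.finiteI_independent)
  have "vec.dim (vec.span S) + vec.dim (vec.span B \<inter> vec.span (S - B))
      = vec.dim (vec.span B) + vec.dim (vec.span (S - B))"
    using vec.dim_sums_Int[OF vec.subspace_span vec.subspace_span, of B "S - B"] assms(2)
    by (simp add: vec.span_Un[symmetric] Un_absorb1)
  moreover have "card S = card B + card (S - B)"
    using fin assms(2) by (simp add: card_Diff_subset finite_subset card_mono)
  ultimately have "vec.dim (vec.span B \<inter> vec.span (S - B)) = 0"
    using assms vec.independent_mono[OF assms(1)]
    by (simp add: vec.dim_eq_card_independent)
  then show ?thesis
    using vec.span_zero by auto
qed

lemma dim_null_space_add_dim_range:
  fixes M :: "'a::field^'n^'m"
  shows "vec.dim {x. M *v x = 0} + vec.dim (range ((*v) M)) = CARD('n)"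
proof -
  let ?K = "{x. M *v x = 0}"
  obtain B where B: "B \<subseteq> ?K" "vec.independent B" "?K \<subseteq> vec.span B" "card B = vec.dim ?K"
    using vec.basis_exists by blast
  obtain S where S: "B \<subseteq> S" "vec.independent S" "UNIV \<subseteq> vec.span S"
    using vec.maximal_independent_subset_extend[OF subset_UNIV B(2)] by metis
  have "finite S"
    using S(2) by (rule vec.finiteI_independent)
  then have card_S: "card S = card B + card (S - B)"
    using S(1) card_mono[of S B] card_Diff_subset[of B S] by (simp add: finite_subset)
  have "card S = CARD('n)"
    using S vec.basis_card_eq_dim[of S UNIV] by (simp add: card_cart_basis)
  have span_B: "vec.span B \<subseteq> ?K"
    using B(1) vec.subspace_kernel by (rule vec.span_minimal)
  have inj: "inj_on ((*v) M) (vec.span (S - B))"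
    using span_inter_span_Diff[OF S(2,1)] B(3)
    by (auto simp: vec.linear_inj_on_iff_eq_0[OF matrix_vector_mul_linear_gen vec.subspace_span])
  have span_S: "vec.span S = {x + y |x y. x \<in> vec.span B \<and> y \<in> vec.span (S - B)}"
    using S(1) vec.span_Un[of B "S - B"] by (simp add: sup.absorb2)
  have "range ((*v) M) = (*v) M ` vec.span (S - B)"
  proof (intro antisym subsetI)
    fix z assume "z \<in> range ((*v) M)"
    then obtain x where "z = M *v x"
      by blast
    moreover obtain b c where "x = b + c" "b \<in> vec.span B" "c \<in> vec.span (S - B)"
      using S(3) span_S by blast
    ultimately have "z = M *v c"
      using span_B by (auto simp: matrix_vector_right_distrib)
    then show "z \<in> (*v) M ` vec.span (S - B)"
      using \<open>c \<in> vec.span (S - B)\<close> by blast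
  qed auto
  moreover have "vec.dim ((*v) M ` vec.span (S - B)) = card (S - B)"
    using vec.dim_image_eq[OF matrix_vector_mul_linear_gen, of M "vec.span (S - B)"] inj
      vec.independent_mono[OF S(2), of "S - B"]
    by (simp add: vec.dim_eq_card_independent vec.span_span)
  ultimately show ?thesis
    using B(4) card_S \<open>card S = CARD('n)\<close> by simp
qed

lemma independent_extends_to_invertible_rows:
  fixes B :: "('a::field^'n) set"
  assumes "vec.independent B"
  obtains g :: "'n \<Rightarrow> 'a^'n" where "inj g" "B \<subseteq> range g" "det (\<chi> j. g j) \<noteq> 0"
proof -
  obtain S where S: "B \<subseteq> S" "S \<subseteq> UNIV" "vec.independent S" "UNIV \<subseteq> vec.span S"
    using vec.maximal_independent_subset_extend[OF subset_UNIV assms] by metis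
  have "finite S" "card S = CARD('n)"
    using S vec.finiteI_independent vec.basis_card_eq_dim[of S UNIV] by (auto simp: card_cart_basis)
  then obtain g where g: "bij_betw g (UNIV :: 'n set) S"
    by (metis finite_same_card_bij finite_class.finite_UNIV)
  have indep: "\<And>c. (\<Sum>v\<in>S. c v *s v) = 0 \<Longrightarrow> \<forall>v\<in>S. c v = 0"
    using S(3) by (simp add: vec.independent_explicit)
  have "\<forall>c. (\<Sum>j\<in>UNIV. c j *s row j (\<chi> j. g j)) = 0 \<longrightarrow> (\<forall>j. c j = 0)"
  proof (rule allI, rule impI)
    fix c :: "'n \<Rightarrow> 'a"
    assume "(\<Sum>j\<in>UNIV. c j *s row j (\<chi> j. g j)) = 0"
    then have "(\<Sum>v\<in>S. c (inv_into UNIV g v) *s v) = 0"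
      using g by (simp add: row_def sum.reindex_bij_betw[OF g, symmetric] bij_betw_inv_into_left)
    then have "\<forall>v\<in>S. c (inv_into UNIV g v) = 0"
      by (rule indep)
    then show "\<forall>j. c j = 0"
      using g by (metis bij_betw_apply bij_betw_inv_into_left UNIV_I)
  qed
  then have "invertible (\<chi> j. g j)"
    unfolding invertible_right_inverse matrix_right_invertible_independent_rows .
  then show thesis
    using g S(1) by (intro that) (auto simp: invertible_det_nz bij_betw_def)
qed

lemma basis_adapted_to_null_space:
  fixes M :: "'a::field^'n^'n"
  assumes "v \<noteq> 0" "M *v v = 0" "M *v w = v"
  obtains g :: "'n \<Rightarrow> 'a^'n" and J j0 j1 where "det (\<chi> j. g j) \<noteq> 0"
    "card J = vec.dim {x. M *v x = 0}" "\<And>j. j \<in> J \<Longrightarrow> M *v g j = 0"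
    "j0 \<in> J" "g j0 = v" "j1 \<notin> J" "g j1 = w"
proof -
  let ?K = "{x. M *v x = 0}"
  have "vec.independent {v}"
    using assms(1) by simp
  then obtain B where B: "{v} \<subseteq> B" "B \<subseteq> ?K" "vec.independent B" "?K \<subseteq> vec.span B"
    using vec.maximal_independent_subset_extend[of "{v}" ?K] assms(2) by blast
  have "vec.span B \<subseteq> ?K"
    using B(2) vec.subspace_kernel by (rule vec.span_minimal)
  then have w_B: "w \<notin> vec.span B"
    using assms by auto
  then have "vec.independent (insert w B)"
    using B(3) by (rule vec.independent_insertI)
  then obtain g where g: "inj g" "insert w B \<subseteq> range g" "det (\<chi> j. g j) \<noteq> 0"
    by (rule independent_extends_to_invertible_rows)
  obtain j0 j1 where "g j0 = v" "g j1 = w"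
    using g(2) B(1) by auto
  moreover have "card (g -` B) = vec.dim ?K"
    using card_vimage_inj[OF g(1)] g(2) B by (simp add: vec.basis_card_eq_dim)
  ultimately show thesis
    using g(3) B(1,2) w_B vec.span_base by (intro that[of g "g -` B" j0 j1]) auto
qed

section \<open>The determinant of \<open>I + u (M - I)\<close>\<close>

lemma det_map_entries:
  fixes f :: "'a::comm_ring_1 \<Rightarrow> 'b::comm_ring_1" and A :: "'a^'n^'n"
  assumes add: "\<And>a b. f (a + b) = f a + f b" and mult: "\<And>a b. f (a * b) = f a * f b"
    and one: "f 1 = 1"
  shows "det (\<chi> i j. f (A $ i $ j)) = f (det A)"
proof -
  have zero: "f 0 = 0"
    using add[of 0 0] by simp
  have uminus: "f (- a) = - f a" for a
    using add[of a "- a"] zero by (simp add: add_eq_0_iff)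
  have sum: "f (sum g S) = (\<Sum>x\<in>S. f (g x))" for g :: "('n \<Rightarrow> 'n) \<Rightarrow> 'a" and S
    by (induction S rule: infinite_finite_induct) (simp_all add: zero add)
  have prod: "f (prod g S) = (\<Prod>x\<in>S. f (g x))" for g :: "'n \<Rightarrow> 'a" and S
    by (induction S rule: infinite_finite_induct) (simp_all add: one mult)
  have sign: "f (of_int (sign p)) = of_int (sign p)" for p :: "'n \<Rightarrow> 'n"
    by (cases rule: sign_cases[of p]) (simp_all add: one uminus)
  show ?thesis
    by (simp add: det_def sum prod sign mult)
qed

lemma pow_card_dvd_det:
  fixes A :: "'a::comm_ring_1^'n^'n"
  assumes "\<And>j i. j \<in> J \<Longrightarrow> q dvd A $ j $ i"
  shows "q ^ card J dvd det A"
  unfolding det_def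
proof (rule dvd_sum)
  fix p :: "'n \<Rightarrow> 'n"
  have "q ^ card J dvd (\<Prod>j\<in>J. A $ j $ p j)"
    using prod_dvd_prod[of J "\<lambda>_. q" "\<lambda>j. A $ j $ p j"] assms by simp
  also have "\<dots> dvd (\<Prod>j\<in>UNIV. A $ j $ p j)"
    by (rule prod_dvd_prod_subset) simp_all
  finally show "q ^ card J dvd of_int (sign p) * (\<Prod>j\<in>UNIV. A $ j $ p j)"
    by (rule dvd_mult)
qed

lemma det_eq_0_if_row_proportional:
  fixes A :: "'a::idom^'n^'n"
  assumes "j0 \<noteq> j1" "q \<noteq> 0" "q *s r = c *s A $ j0"
  shows "det (\<chi> j. if j = j1 then r else A $ j) = 0"
proof -
  have "q * det (\<chi> j. if j = j1 then r else A $ j) = det (\<chi> j. if j = j1 then q *s r else A $ j)"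
    using det_row_mul[of j1 q "\<lambda>_. r" "\<lambda>j. A $ j"] by simp
  also have "\<dots> = det (\<chi> j. if j = j1 then c *s A $ j0 else A $ j)"
    by (simp only: assms(3))
  also have "\<dots> = c * det (\<chi> j. if j = j1 then A $ j0 else A $ j)"
    by (rule det_row_mul)
  also have "det (\<chi> j. if j = j1 then A $ j0 else A $ j) = 0"
    using assms(1) by (intro det_identical_rows[of j0 j1]) (auto simp: row_def)
  finally show ?thesis
    using assms(2) by simp
qed

lemma det_mat_vec_mult_const_rows:
  fixes N :: "'a::comm_ring_1 poly^'n^'n"
  shows "det (\<chi> j. N *v (\<chi> i. [:g j $ i:])) = smult (det (\<chi> j. g j)) (det N)"
proof -
  have "(\<chi> j. N *v (\<chi> i. [:g j $ i:])) = (\<chi> j i. [:g j $ i:]) ** transpose N"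
    by (simp add: vec_eq_iff matrix_matrix_mult_def matrix_vector_mult_def transpose_def
        mult.commute)
  moreover have "det (\<chi> j i. [:g j $ i:]) = [:det (\<chi> j. g j):]"
    using det_map_entries[of "\<lambda>a. [:a:]" "\<chi> j. g j"] by simp
  ultimately show ?thesis
    by (simp add: det_mul)
qed

text \<open>For \<open>M = I - A\<close> the linear pencil is \<open>I - A u\<close>.\<close>

definition linear_pencil :: "'a::comm_ring_1^'n^'n \<Rightarrow> 'a poly^'n^'n" where
  "linear_pencil M = (\<chi> i j. [:mat 1 $ i $ j, (M - mat 1) $ i $ j:])"

lemma poly_det_linear_pencil_0: "poly (det (linear_pencil M)) 0 = 1"
proof -
  have "poly (det (linear_pencil M)) 0 = det (\<chi> i j. poly (linear_pencil M $ i $ j) 0)"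
    by (rule det_map_entries[symmetric]) simp_all
  also have "(\<chi> i j. poly (linear_pencil M $ i $ j) 0) = mat 1"
    by (simp add: linear_pencil_def vec_eq_iff)
  finally show ?thesis
    by simp
qed

lemma sum_pCons_linear: "(\<Sum>j\<in>A. [:a j, b j:]) = [:sum a A, sum b A:]"
  by (induction A rule: infinite_finite_induct) simp_all

lemma linear_pencil_mult_const_vec:
  "linear_pencil M *v (\<chi> i. [:x $ i:]) = (\<chi> i. [:x $ i, (M *v x) $ i - x $ i:])"
proof -
  have "(linear_pencil M *v (\<chi> i. [:x $ i:])) $ i
      = (\<Sum>j\<in>UNIV. [:x $ j * mat 1 $ i $ j, x $ j * (M - mat 1) $ i $ j:])" for i
    by (simp add: linear_pencil_def matrix_vector_mult_def mult.commute)
  also have "\<dots> i = [:(mat 1 *v x) $ i, ((M - mat 1) *v x) $ i:]" for i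
    by (simp add: sum_pCons_linear matrix_vector_mult_def mult.commute)
  finally show ?thesis
    by (simp add: vec_eq_iff matrix_vector_mult_diff_rdistrib)
qed

lemma pow_dim_null_space_dvd_det_linear_pencil:
  fixes M :: "'a::field^'n^'n"
  assumes "v \<noteq> 0" "M *v v = 0" "M *v w = v"
  shows "[:-1, 1:] ^ Suc (vec.dim {x. M *v x = 0}) dvd det (linear_pencil M)"
proof -
  obtain g J j0 j1 where g: "det (\<chi> j. g j) \<noteq> 0" and card_J: "card J = vec.dim {x. M *v x = 0}"
    and ker: "\<And>j. j \<in> J \<Longrightarrow> M *v g j = 0"
    and j0: "j0 \<in> J" "g j0 = v" and j1: "j1 \<notin> J" "g j1 = w"
    using basis_adapted_to_null_space[OF assms] by blast
  define T where "T = (\<chi> j. linear_pencil M *v (\<chi> i. [:g j $ i:]))"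
  have T_rows: "T $ j = (\<chi> i. [:g j $ i, (M *v g j) $ i - g j $ i:])" for j
    by (simp add: T_def linear_pencil_mult_const_vec)
  \<comment> \<open>Row \<open>j1\<close> of \<open>T\<close> is \<open>(1 - u) w + u v\<close>, and \<open>u v\<close> is proportional to row \<open>j0\<close>.\<close>
  define U where "U r = (\<chi> j. if j = j1 then r else T $ j)" for r
  define a where "a = (\<chi> i. [:w $ i, - w $ i:])"
  define b where "b = (\<chi> i. [:0, v $ i:])"
  have "T = U (a + b)"
    by (simp add: U_def a_def b_def vec_eq_iff T_rows j1(2) assms(3))
  then have "det T = det (U a) + det (U b)"
    using det_row_add[of j1 "\<lambda>_. a" "\<lambda>_. b" "\<lambda>j. T $ j"] by (simp add: U_def)
  moreover have "det (U b) = 0"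
    unfolding U_def using j0 j1
    by (intro det_eq_0_if_row_proportional[of j0 j1 "[:1, -1:]" _ "[:0, 1:]"])
      (auto simp: b_def T_rows j0(2) assms(2) vec_eq_iff)
  moreover have "[:-1, 1:] ^ card (insert j1 J) dvd det (U a)"
  proof (rule pow_card_dvd_det)
    have "[:-1, 1:] dvd [:c, - c:]" for c :: 'a
      by (rule dvdI[of _ _ "[:- c:]"]) simp
    then show "[:-1, 1:] dvd U a $ j $ i" if "j \<in> insert j1 J" for j i
      using that ker by (auto simp: U_def a_def T_rows)
  qed
  ultimately have "[:-1, 1:] ^ Suc (vec.dim {x. M *v x = 0}) dvd
      smult (det (\<chi> j. g j)) (det (linear_pencil M))"
    using j1 card_J by (simp add: T_def det_mat_vec_mult_const_rows)
  then show ?thesis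
    using g by (rule dvd_smult_cancel)
qed

section \<open>Integer polynomials as rational polynomials\<close>

lemma map_poly_of_int_add: "map_poly of_int (p + q) = map_poly of_int p + map_poly of_int q"
  by (rule poly_eqI) (simp add: coeff_map_poly)

lemma map_poly_of_int_mult:
  "map_poly (of_int :: int \<Rightarrow> 'a::comm_ring_1) (p * q) = map_poly of_int p * map_poly of_int q"
  by (rule poly_eqI) (simp add: coeff_map_poly coeff_mult)

lemma map_poly_of_int_power:
  "map_poly (of_int :: int \<Rightarrow> 'a::comm_ring_1) (p ^ n) = map_poly of_int p ^ n"
  by (induction n) (simp_all add: map_poly_of_int_mult)

lemma poly_map_poly_of_int: "poly (map_poly of_int p) (of_int x) = of_int (poly p x)"
  by (induction p) (simp_all add: map_poly_pCons)

lemma order_map_poly_of_int: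
  fixes p :: "int poly"
  assumes "p \<noteq> 0"
  shows "order (of_int a) (map_poly (of_int :: int \<Rightarrow> 'a::{idom, ring_char_0}) p) = order a p"
proof -
  obtain q where q: "p = [:-a, 1:] ^ order a p * q" "\<not> [:-a, 1:] dvd q"
    using order_decomp[OF assms] by blast
  have "poly q a \<noteq> 0"
    using q(2) by (simp add: poly_eq_0_iff_dvd)
  then have "order (of_int a) (map_poly (of_int :: int \<Rightarrow> 'a) q) = 0"
    by (intro order_0I) (simp add: poly_map_poly_of_int)
  moreover have "map_poly (of_int :: int \<Rightarrow> 'a) p = [:- of_int a, 1:] ^ order a p * map_poly of_int q"
    by (subst q(1)) (simp add: map_poly_of_int_mult map_poly_of_int_power map_poly_pCons)
  moreover have "map_poly (of_int :: int \<Rightarrow> 'a) p \<noteq> 0"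
    using assms by (simp add: map_poly_eq_0_iff)
  ultimately show ?thesis
    by (simp add: order_mult order_power_n_n)
qed

section \<open>Ranks of lattices\<close>

definition independent_mod :: "('a::field^'n) set \<Rightarrow> ('a^'n) set \<Rightarrow> bool" where
  "independent_mod W G \<longleftrightarrow> finite G \<and> (\<forall>c. (\<Sum>v\<in>G. c v *s v) \<in> W \<longrightarrow> (\<forall>v\<in>G. c v = 0))"

lemma independent_mod_0_iff: "independent_mod {0} G \<longleftrightarrow> vec.independent G"
  by (auto simp: independent_mod_def vec.independent_explicit)

lemma independent_mod_if_zindep_mod:
  fixes A :: "int^'n^'m"
  assumes "finite F" and zindep: "zindep_mod (range ((*v) A)) F"
  shows "independent_mod (range ((*v) (of_int_mat A))) (to_Q ` F)"
  unfolding independent_mod_def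
proof (intro conjI allI impI)
  fix c
  assume "(\<Sum>v\<in>to_Q ` F. c v *s v) \<in> range ((*v) (of_int_mat A))"
  then obtain y where y: "(\<Sum>x\<in>F. c (to_Q x) *s to_Q x) = of_int_mat A *v y"
    by (auto simp: sum_image_to_Q)
  define S where "S = (\<lambda>x. c (to_Q x)) ` F \<union> range (($) y)"
  have "finite S"
    using assms(1) by (simp add: S_def)
  from common_denominator[OF this]
  obtain D :: int where D: "D > 0" "\<forall>q\<in>S. of_int D * q \<in> \<int>"
    by blast
  have "\<forall>x\<in>F. \<exists>z. of_int D * c (to_Q x) = of_int z"
    using D(2) by (auto simp: S_def Ints_def)
  then obtain d where d: "\<forall>x\<in>F. of_int D * c (to_Q x) = of_int (d x)"
    by (rule bchoice[THEN exE])
  obtain z where z: "to_Q z = of_int D *s y"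
    using D(2) range_to_Q_iff[of "of_int D *s y"] by (auto simp: S_def)
  have "to_Q (\<Sum>x\<in>F. d x *s x) = of_int D *s (\<Sum>x\<in>F. c (to_Q x) *s to_Q x)"
    using d by (simp add: to_Q_sum vec.scale_sum_right flip: vector_smult_assoc)
  also have "\<dots> = to_Q (A *v z)"
    by (simp add: y z to_Q_mat_vec_mult vec.scale del: vector_smult_assoc)
  finally have "(\<Sum>x\<in>F. d x *s x) = A *v z"
    by (rule injD[OF inj_to_Q])
  then have "\<forall>x\<in>F. d x = 0"
    using zindep unfolding zindep_mod_def by blast
  then show "\<forall>v\<in>to_Q ` F. c v = 0"
    using d D(1) by fastforce
qed (use assms(1) in simp)

lemma zindep_mod_if_independent_mod:
  fixes A :: "int^'n^'m"
  assumes indep: "independent_mod (range ((*v) (of_int_mat A))) (to_Q ` F)"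
  shows "zindep_mod (range ((*v) A)) F"
  unfolding zindep_mod_def
proof (intro allI impI)
  fix c :: "int^'m \<Rightarrow> int"
  assume "(\<Sum>x\<in>F. c x *s x) \<in> range ((*v) A)"
  then obtain y where "(\<Sum>x\<in>F. c x *s x) = A *v y"
    by auto
  then have "to_Q (\<Sum>x\<in>F. c x *s x) = to_Q (A *v y)"
    by simp
  then have "(\<Sum>x\<in>F. of_int (c x) *s to_Q x) = of_int_mat A *v to_Q y"
    by (simp add: to_Q_sum to_Q_mat_vec_mult)
  then have "(\<Sum>v\<in>to_Q ` F. of_int (c (inv_into F to_Q v)) *s v) \<in> range ((*v) (of_int_mat A))"
    by (simp add: sum_image_to_Q inv_into_f_f[OF inj_on_to_Q] cong: sum.cong)
  then have "\<forall>v\<in>to_Q ` F. of_int (c (inv_into F to_Q v)) = (0::rat)"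
    using indep unfolding independent_mod_def
    by (blast dest: spec[of _ "\<lambda>v. of_int (c (inv_into F to_Q v))"])
  then show "\<forall>x\<in>F. c x = 0"
    by (simp add: inv_into_f_f[OF inj_on_to_Q])
qed

lemma zindep_mod_range_iff:
  fixes A :: "int^'n^'m"
  assumes "finite F"
  shows "zindep_mod (range ((*v) A)) F \<longleftrightarrow>
    independent_mod (range ((*v) (of_int_mat A))) (to_Q ` F)"
  using independent_mod_if_zindep_mod[OF assms] zindep_mod_if_independent_mod by (rule iffI)

lemma zindep_mod_0_iff:
  fixes F :: "(int^'n) set"
  assumes "finite F"
  shows "zindep_mod {0} F \<longleftrightarrow> vec.independent (to_Q ` F)"
proof -
  have "range ((*v) (0 :: int^'n^'n)) = {0}" and "of_int_mat (0 :: int^'n^'n) = 0"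
    by (auto simp: of_int_mat_def vec_eq_iff)
  then show ?thesis
    using zindep_mod_range_iff[OF assms, of "0 :: int^'n^'n"]
    by (simp add: independent_mod_0_iff)
qed

lemma zrank_eq_dim: "zrank S = vec.dim (to_Q ` S)"
  unfolding zrank_def zrank_quot_def
proof (rule cSup_eq_maximum)
  obtain B where B: "B \<subseteq> to_Q ` S" "vec.independent B" "to_Q ` S \<subseteq> vec.span B"
    "card B = vec.dim (to_Q ` S)"
    using vec.basis_exists by blast
  obtain F where F: "F \<subseteq> S" "B = to_Q ` F"
    using subset_imageE[OF B(1)] by blast
  have "finite F"
    using vec.finiteI_independent[OF B(2)] F(2) by simp
  then have "F \<in> {F. finite F \<and> F \<subseteq> S \<and> zindep_mod {0} F}"
    using F B(2) by (simp add: zindep_mod_0_iff)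
  moreover have "vec.dim (to_Q ` S) = card F"
    using B(4) F(2) by simp
  ultimately show "vec.dim (to_Q ` S) \<in> card ` {F. finite F \<and> F \<subseteq> S \<and> zindep_mod {0} F}"
    by (rule rev_image_eqI)
next
  fix n assume "n \<in> card ` {F. finite F \<and> F \<subseteq> S \<and> zindep_mod {0} F}"
  then obtain F where F: "finite F" "F \<subseteq> S" "zindep_mod {0} F" and n: "n = card F"
    by blast
  have "card (to_Q ` F) \<le> vec.dim (to_Q ` S)"
    using F by (intro vec.independent_card_le_dim) (auto simp: zindep_mod_0_iff)
  then show "n \<le> vec.dim (to_Q ` S)"
    by (simp add: n)
qed

lemma card_add_dim_le_if_independent_mod:
  fixes W :: "('a::field^'n) set"
  assumes W: "vec.subspace W" and G: "independent_mod W G"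
  shows "card G + vec.dim W \<le> CARD('n)"
proof -
  have fin: "finite G" and indep_mod: "\<And>c. (\<Sum>v\<in>G. c v *s v) \<in> W \<Longrightarrow> \<forall>v\<in>G. c v = 0"
    using G by (auto simp: independent_mod_def)
  have "vec.independent G"
    unfolding vec.independent_explicit
  proof (intro conjI allI impI)
    fix c assume "(\<Sum>v\<in>G. c v *s v) = 0"
    then show "\<forall>v\<in>G. c v = 0"
      by (intro indep_mod) (simp add: vec.subspace_0[OF W])
  qed (fact fin)
  moreover have "vec.span G \<inter> W = {0}"
  proof
    show "vec.span G \<inter> W \<subseteq> {0}"
    proof
      fix x assume x: "x \<in> vec.span G \<inter> W"
      then obtain c where c: "x = (\<Sum>v\<in>G. c v *s v)"
        using vec.span_finite[OF fin] by blast
      then have "\<forall>v\<in>G. c v = 0"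
        using x by (intro indep_mod) simp
      then show "x \<in> {0}"
        by (simp add: c)
    qed
    show "{0} \<subseteq> vec.span G \<inter> W"
      by (simp add: vec.span_zero vec.subspace_0[OF W])
  qed
  ultimately have "vec.dim {x + y |x y. x \<in> vec.span G \<and> y \<in> W} = card G + vec.dim W"
    using vec.dim_sums_Int[OF vec.subspace_span W, of G]
    by (simp add: vec.dim_eq_card_independent)
  then show ?thesis
    using dim_subset_UNIV_cart_gen[of "{x + y |x y. x \<in> vec.span G \<and> y \<in> W}"] by simp
qed

lemma zrank_quot_range_le:
  fixes A :: "int^'n^'m"
  shows "zrank_quot UNIV (range ((*v) A)) + vec.dim (range ((*v) (of_int_mat A))) \<le> CARD('m)"
proof -
  let ?W = "range ((*v) (of_int_mat A))"
  have "vec.subspace ?W"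
    by (simp add: vec.subspace_image)
  then have bound: "card F \<le> CARD('m) - vec.dim ?W"
    if "finite F" "zindep_mod (range ((*v) A)) F" for F
    using that card_add_dim_le_if_independent_mod[of ?W "to_Q ` F"]
    by (simp add: zindep_mod_range_iff)
  have "{} \<in> {F. finite F \<and> F \<subseteq> UNIV \<and> zindep_mod (range ((*v) A)) F}"
    by (simp add: zindep_mod_def)
  then have "zrank_quot UNIV (range ((*v) A)) \<le> CARD('m) - vec.dim ?W"
    unfolding zrank_quot_def using bound by (intro cSup_least) blast+
  then show ?thesis
    using dim_subset_UNIV_cart_gen[of ?W] by linarith
qed

lemma zrank_lattice_points:
  assumes "vec.subspace W"
  shows "zrank {z. to_Q z \<in> W} = vec.dim W"
  using vec.dim_span[of "to_Q ` {z. to_Q z \<in> W}"]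
  by (simp add: zrank_eq_dim span_lattice_points[OF assms])

lemma zrank_range_mat_vec_mult: "zrank (range ((*v) A)) = vec.dim (range ((*v) (of_int_mat A)))"
proof -
  have "to_Q ` range ((*v) A) = (*v) (of_int_mat A) ` range to_Q"
    by (auto simp: to_Q_mat_vec_mult image_iff)
  then have "zrank (range ((*v) A)) = vec.dim (vec.span ((*v) (of_int_mat A) ` range to_Q))"
    by (simp add: zrank_eq_dim)
  also have "\<dots> = vec.dim (range ((*v) (of_int_mat A)))"
    by (simp add: vec.span_image span_range_to_Q)
  finally show ?thesis .
qed

lemma zrank_image_lattice_points:
  fixes A :: "int^'n^'n"
  defines "W \<equiv> range ((*v) (of_int_mat A))"
  assumes "\<And>v. of_int_mat A *v v = 0 \<Longrightarrow> v \<in> W \<Longrightarrow> v = 0"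
  shows "zrank ((*v) A ` {z. to_Q z \<in> W}) = vec.dim W"
proof -
  have W: "vec.subspace W"
    by (simp add: W_def vec.subspace_image)
  have "inj_on ((*v) (of_int_mat A)) W"
    using assms(2) by (simp add: vec.linear_inj_on_iff_eq_0[OF matrix_vector_mul_linear_gen W])
  moreover have "vec.dim (to_Q ` {z. to_Q z \<in> W}) = vec.dim W"
    using zrank_lattice_points[OF W] by (simp add: zrank_eq_dim)
  ultimately have "vec.dim ((*v) (of_int_mat A) ` to_Q ` {z. to_Q z \<in> W}) = vec.dim W"
    using vec.dim_image_eq[OF matrix_vector_mul_linear_gen, of "of_int_mat A" "to_Q ` {z. to_Q z \<in> W}"]
    by (simp add: span_lattice_points[OF W])
  moreover have "to_Q ` (*v) A ` {z. to_Q z \<in> W} = (*v) (of_int_mat A) ` to_Q ` {z. to_Q z \<in> W}"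
    by (simp add: image_image to_Q_mat_vec_mult)
  ultimately show ?thesis
    by (simp add: zrank_eq_dim)
qed

section \<open>The Bowen-Franks operator\<close>

lemma BF_Q_eq: "BF_Q E o' t = (*v) (of_int_mat (BF_mat E o' t))"
  by (simp add: fun_eq_iff BF_Q_def of_int_mat_def)

lemma of_int_zeta_poly:
  fixes o' t :: "'e \<Rightarrow> 'v::finite"
  shows "map_poly of_int (zeta_poly E o' t) = det (linear_pencil (of_int_mat (BF_mat E o' t)))"
proof -
  define Z :: "int poly^'v^'v" where
    "Z = (\<chi> i j. (if i = j then 1 else 0) - [:0, of_int (adj_mat E o' t $ i $ j):])"
  have "map_poly of_int (zeta_poly E o' t) = det (\<chi> i j. map_poly of_int (Z $ i $ j))"
    unfolding zeta_poly_def Z_def[symmetric]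
    by (rule det_map_entries[symmetric]) (simp_all add: map_poly_of_int_add map_poly_of_int_mult)
  also have "(\<chi> i j. map_poly of_int (Z $ i $ j)) = linear_pencil (of_int_mat (BF_mat E o' t))"
    by (simp add: Z_def vec_eq_iff linear_pencil_def of_int_mat_def BF_mat_def mat_def
        map_poly_pCons one_pCons)
  finally show ?thesis .
qed

lemma zeta_poly_nonzero: "zeta_poly E o' t \<noteq> 0"
proof -
  have "poly (map_poly of_int (zeta_poly E o' t)) 0 = (1 :: rat)"
    by (simp add: of_int_zeta_poly poly_det_linear_pencil_0)
  then show ?thesis
    by auto
qed

lemma r_X_eq_order: "r_X E o' t = order 1 (det (linear_pencil (of_int_mat (BF_mat E o' t))))"
proof -
  have "order (of_int 1) (map_poly (of_int :: int \<Rightarrow> rat) (zeta_poly E o' t)) = r_X E o' t"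
    unfolding r_X_def by (rule order_map_poly_of_int[OF zeta_poly_nonzero])
  then show ?thesis
    by (simp add: of_int_zeta_poly)
qed

lemma rank_BF_group_le_dim_null_space:
  "rank_BF_group E o' t \<le> vec.dim {x. of_int_mat (BF_mat E o' t) *v x = 0}"
  using zrank_quot_range_le[of "BF_mat E o' t"]
    dim_null_space_add_dim_range[of "of_int_mat (BF_mat E o' t)"]
  by (simp add: rank_BF_group_def BF_def[abs_def])

lemma null_space_inter_range_trivial:
  assumes "delta E o' t = 0"
    and "of_int_mat (BF_mat E o' t) *v v = 0" "v \<in> range ((*v) (of_int_mat (BF_mat E o' t)))"
  shows "v = 0"
proof (rule ccontr)
  let ?M = "of_int_mat (BF_mat E o' t)"
  assume "v \<noteq> 0"
  then have "[:-1, 1:] ^ Suc (vec.dim {x. ?M *v x = 0}) dvd det (linear_pencil ?M)"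
    using assms(2,3) pow_dim_null_space_dvd_det_linear_pencil by blast
  moreover have "det (linear_pencil ?M) \<noteq> 0"
    using poly_det_linear_pencil_0[of ?M] by force
  ultimately have "Suc (vec.dim {x. ?M *v x = 0}) \<le> r_X E o' t"
    unfolding r_X_eq_order by (simp only: order_divides) blast
  then show False
    using assms(1) rank_BF_group_le_dim_null_space[of E o' t] by (simp add: delta_def)
qed

theorem proposition2p9:
  fixes E :: "'e set" and o' t :: "'e \<Rightarrow> 'v::finite"
  assumes "finite E"
    and "strongly_connected E o' t"
    and "delta E o' t = 0"
  shows "BF E o' t ` L_X E o' t \<subseteq> range (BF E o' t)
       \<and> range (BF E o' t) \<subseteq> L_X E o' t
       \<and> zrank (BF E o' t ` L_X E o' t) = zrank (range (BF E o' t))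
       \<and> zrank (range (BF E o' t)) = zrank (L_X E o' t)"
proof -
  define A where "A = BF_mat E o' t"
  define W where "W = range ((*v) (of_int_mat A))"
  have BF: "BF E o' t = (*v) A"
    by (simp add: fun_eq_iff BF_def A_def)
  have L: "L_X E o' t = {z. to_Q z \<in> W}"
    by (simp add: L_X_def BF_Q_eq W_def A_def)
  have "range (BF E o' t) \<subseteq> L_X E o' t"
    by (auto simp: BF L W_def to_Q_mat_vec_mult)
  moreover have "zrank (BF E o' t ` L_X E o' t) = vec.dim W"
    unfolding BF L W_def using null_space_inter_range_trivial[OF assms(3)]
    by (intro zrank_image_lattice_points) (simp add: A_def)
  moreover have "zrank (range (BF E o' t)) = vec.dim W"
    by (simp add: BF W_def zrank_range_mat_vec_mult)
  moreover have "zrank (L_X E o' t) = vec.dim W"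
    by (simp add: L W_def zrank_lattice_points vec.subspace_image)
  ultimately show ?thesis
    by auto
qed

end
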